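(* Let $(X,d)$ be a metric space of finite asymptotic dimension $\operatorname{asdim}(X,d)=n$. Then there exists a function $f\colon[0,\infty)\to[0,\infty)$ such that $d'=f\circ d$ is a metric on $X$ which is hyperbolic, coarsely equivalent to $d$ and topologically equivalent to $d$, and such that the asymptotic Assouad-Nagata dimension satisfies $\operatorname{asdim}_{AN}(X,d')=n$.
   Context: Write $\mathbb{R}_+=[0,\infty)$. An $n$-dimensional control function for a metric space $X$ is any function $D_X\colon\mathbb{R}_+\to\mathbb{R}_+\cup\{\infty\}$ such that for every $r\in\mathbb{R}_+$ there is a cover $\mathcal U=\bigcup_{i=1}^{n+1}\mathcal U_i$ of $X$ such that each family $\mathcal U_i$ is $r$-disjoint (points lying in distinct members of $\mathcal U_i$ are at distance at least $r$) and the diameter of every element of $\mathcal U$ is at most $D_X(r)$. One writes $\operatorname{asdim}X\le n$ if $X$ has a real-valued $n$-dimensional control function, and $\operatorname{asdim}_{AN}X\le n$ if $X$ has an affine $n$-dimensional control function ($r\mapsto Ar+B$ with real $A,B$). $\operatorname{asdim}X$ (resp. $\operatorname{asdim}_{AN}X$) is the least integer $n\ge 0$ with $\operatorname{asdim}X\le n$ (resp. $\operatorname{asdim}_{AN}X\le n$), and $\infty$ if there is none. Two metrics $d,d'$ on $X$ are coarsely equivalent if the identity map $(X,d)\to(X,d')$ is a coarse equivalence, i.e. there are nondecreasing unbounded functions $\phi,\Phi\colon[0,\infty)\to[0,\infty)$ with $\phi(d(x,y))\le d'(x,y)\le\Phi(d(x,y))$ for all $x,y\in X$; they are topologically equivalent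 if they induce the same topology. A metric $d$ on $X$ is hyperbolic (in the sense of Gromov, with no geodesicity assumed) if there is $\delta\ge0$ such that $(x|z)_w\ge\min\{(x|y)_w,(y|z)_w\}-\delta$ for all $x,y,z,w\in X$, where $(x|y)_w=\frac12\big(d(x,w)+d(y,w)-d(x,y)\big)$. *)

theory Defs
  imports "HOL-Analysis.Analysis"
begin

definition ediam :: "('a \<Rightarrow> 'a \<Rightarrow> real) \<Rightarrow> 'a set \<Rightarrow> ennreal" where
  "ediam d U = (SUP (x, y) \<in> U \<times> U. ennreal (d x y))"

definition r_disjoint :: "('a \<Rightarrow> 'a \<Rightarrow> real) \<Rightarrow> real \<Rightarrow> 'a set set \<Rightarrow> bool" where
  "r_disjoint d r \<U> \<longleftrightarrow>
     (\<forall>U\<in>\<U>. \<forall>V\<in>\<U>. U \<noteq> V \<longrightarrow> (\<forall>x\<in>U. \<forall>y\<in>V. r \<le> d x y))"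

text \<open>Only the values of \<open>D\<close> on \<open>[0, \<infinity>)\<close> matter.\<close>

definition control_function ::
    "'a set \<Rightarrow> ('a \<Rightarrow> 'a \<Rightarrow> real) \<Rightarrow> nat \<Rightarrow> (real \<Rightarrow> ennreal) \<Rightarrow> bool" where
  "control_function M d n D \<longleftrightarrow>
     (\<forall>r\<ge>0. \<exists>\<U> :: nat \<Rightarrow> 'a set set.
        (\<Union>i\<in>{1..n+1}. \<Union>(\<U> i)) = M \<and>
        (\<forall>i\<in>{1..n+1}. r_disjoint d r (\<U> i)) \<and>
        (\<forall>i\<in>{1..n+1}. \<forall>U\<in>\<U> i. ediam d U \<le> D r))"

definition asdim_le :: "'a set \<Rightarrow> ('a \<Rightarrow> 'a \<Rightarrow> real) \<Rightarrow> nat \<Rightarrow> bool" where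
  "asdim_le M d n \<longleftrightarrow> (\<exists>D. control_function M d n D \<and> (\<forall>r\<ge>0. D r \<noteq> \<infinity>))"

text \<open>The condition \<open>0 \<le> A * r + B\<close> makes the affine function take values in \<open>[0, \<infinity>)\<close>,
  so that \<^const>\<open>ennreal\<close> does not truncate it.\<close>

definition asdim_AN_le :: "'a set \<Rightarrow> ('a \<Rightarrow> 'a \<Rightarrow> real) \<Rightarrow> nat \<Rightarrow> bool" where
  "asdim_AN_le M d n \<longleftrightarrow>
     (\<exists>D. control_function M d n D \<and>
        (\<exists>A B :: real. \<forall>r\<ge>0. 0 \<le> A * r + B \<and> D r = ennreal (A * r + B)))"

definition asdim :: "'a set \<Rightarrow> ('a \<Rightarrow> 'a \<Rightarrow> real) \<Rightarrow> enat" where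
  "asdim M d = (if \<exists>n. asdim_le M d n then enat (LEAST n. asdim_le M d n) else \<infinity>)"

definition asdim_AN :: "'a set \<Rightarrow> ('a \<Rightarrow> 'a \<Rightarrow> real) \<Rightarrow> enat" where
  "asdim_AN M d = (if \<exists>n. asdim_AN_le M d n then enat (LEAST n. asdim_AN_le M d n) else \<infinity>)"

definition coarsely_equivalent ::
    "'a set \<Rightarrow> ('a \<Rightarrow> 'a \<Rightarrow> real) \<Rightarrow> ('a \<Rightarrow> 'a \<Rightarrow> real) \<Rightarrow> bool" where
  "coarsely_equivalent M d d' \<longleftrightarrow>
     (\<exists>\<phi> \<Phi> :: real \<Rightarrow> real.
        \<phi> \<in> {0..} \<rightarrow> {0..} \<and> mono_on {0..} \<phi> \<and> \<not> bdd_above (\<phi> ` {0..}) \<and>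
        \<Phi> \<in> {0..} \<rightarrow> {0..} \<and> mono_on {0..} \<Phi> \<and> \<not> bdd_above (\<Phi> ` {0..}) \<and>
        (\<forall>x\<in>M. \<forall>y\<in>M. \<phi> (d x y) \<le> d' x y \<and> d' x y \<le> \<Phi> (d x y)))"

definition topologically_equivalent ::
    "'a set \<Rightarrow> ('a \<Rightarrow> 'a \<Rightarrow> real) \<Rightarrow> ('a \<Rightarrow> 'a \<Rightarrow> real) \<Rightarrow> bool" where
  "topologically_equivalent M d d' \<longleftrightarrow>
     Metric_space.mtopology M d = Metric_space.mtopology M d'"

definition gromov_product :: "('a \<Rightarrow> 'a \<Rightarrow> real) \<Rightarrow> 'a \<Rightarrow> 'a \<Rightarrow> 'a \<Rightarrow> real" where
  "gromov_product d w x y = (d x w + d y w - d x y) / 2"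

definition hyperbolic_metric :: "'a set \<Rightarrow> ('a \<Rightarrow> 'a \<Rightarrow> real) \<Rightarrow> bool" where
  "hyperbolic_metric M d \<longleftrightarrow>
     (\<exists>\<delta>\<ge>0. \<forall>x\<in>M. \<forall>y\<in>M. \<forall>z\<in>M. \<forall>w\<in>M.
        gromov_product d w x z \<ge>
          min (gromov_product d w x y) (gromov_product d w y z) - \<delta>)"

end

theory Submission imports Defs begin

text \<open>
  Let \<open>D\<close> be a real-valued control function for \<open>d\<close>.  Choose \<open>r 0 = 1\<close> and
  \<open>r (k + 1) \<ge> max (2 * r k) (D (r k))\<close>, and let \<open>f\<close> be the infimum of the affine functions
  \<open>t \<mapsto> k + t / r k\<close>.  Then \<open>k \<le> f (r k) \<le> k + 1\<close>, so a cover that is \<open>r k\<close>-disjoint with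
  diameters at most \<open>D (r k)\<close> for \<open>d\<close> is \<open>k\<close>-disjoint with diameters at most \<open>k + 2\<close> for \<open>f \<circ> d\<close>.
  Doubling the argument raises \<open>f\<close> by at most 1, so \<open>f \<circ> d\<close> satisfies the ultrametric inequality
  up to an additive constant; this forces hyperbolicity.  The dimension cannot drop, because
  asymptotic dimension is a coarse invariant.
\<close>

section \<open>Criteria for hyperbolicity and for the dimension\<close>

lemma ediam_le_ennreal_iff:
  assumes "0 \<le> c"
  shows "ediam d U \<le> ennreal c \<longleftrightarrow> (\<forall>x\<in>U. \<forall>y\<in>U. d x y \<le> c)"
  using assms by (auto simp: ediam_def SUP_le_iff ennreal_le_iff)

text \<open>If \<open>x y\<close> is the longest side of the quadrilateral \<open>x y z w\<close>,
  each diagonal is, up to \<open>C\<close>, at most \<open>d x y\<close> and at most the larger of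
  the two sides opposite to \<open>x y\<close> in its triangle. Either \<open>d z w\<close> bounds
  one diagonal and \<open>d x y\<close> the other, or \<open>d x w\<close> and \<open>d y z\<close>
  bound them. The resulting four-point inequality is the Gromov inequality with constant
  \<open>C\<close>.\<close>

lemma hyperbolic_metric_if_quasi_ultrametric:
  assumes sym: "\<And>x y. d x y = d y x"
    and ultra: "\<And>x y z. x \<in> M \<Longrightarrow> y \<in> M \<Longrightarrow> z \<in> M \<Longrightarrow> d x z \<le> max (d x y) (d y z) + C"
    and "0 \<le> C"
  shows "hyperbolic_metric M d"
  unfolding hyperbolic_metric_def
proof (intro exI[of _ C] conjI ballI)
  fix x y z w assume M: "x \<in> M" "y \<in> M" "z \<in> M" "w \<in> M"
  have "d x z \<le> max (d x y) (d y z) + C" "d x z \<le> max (d x w) (d z w) + C"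
    "d y w \<le> max (d x y) (d x w) + C" "d y w \<le> max (d y z) (d z w) + C"
    using M ultra[of x y z] ultra[of x w z] ultra[of y x w] ultra[of y z w] sym by auto
  then have "d x z + d y w \<le> max (d x y + d z w) (d y z + d x w) + 2 * C"
    unfolding max_def by (auto split: if_splits)
  then show "gromov_product d w x z
      \<ge> min (gromov_product d w x y) (gromov_product d w y z) - C"
    unfolding gromov_product_def min_def max_def by (auto split: if_splits simp: field_simps)
qed (fact assms)

text \<open>An affine control function is real-valued, so a smaller Assouad-Nagata bound for
  \<open>d'\<close> would pass to \<open>d\<close> and contradict the minimality of
  \<open>n\<close>.\<close>

lemma asdim_AN_eq_asdim:
  assumes "asdim M d = enat n" and "asdim_AN_le M d' n"
    and "\<And>m. asdim_le M d' m \<Longrightarrow> asdim_le M d m"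
  shows "asdim_AN M d' = enat n"
proof -
  have least: "(LEAST m. asdim_le M d m) = n"
    using assms(1) by (auto simp: asdim_def split: if_splits)
  have "asdim_le M d' m" if "asdim_AN_le M d' m" for m
    using that unfolding asdim_le_def asdim_AN_le_def by (metis ennreal_neq_top infinity_ennreal_def)
  then have "n \<le> m" if "asdim_AN_le M d' m" for m
    using that assms(3) least by (metis Least_le)
  then have "(LEAST m. asdim_AN_le M d' m) = n"
    using assms(2) by (intro Least_equality) auto
  then show ?thesis
    using assms(2) by (auto simp: asdim_AN_def)
qed

section \<open>The rescaling function\<close>

locale doubling_sequence =
  fixes r :: "nat \<Rightarrow> real"
  assumes r_0: "r 0 = 1" and r_double: "2 * r k \<le> r (Suc k)"
begin

lemma r_pos: "0 < r k"
proof (induction k)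
  case (Suc k)
  then show ?case using r_double[of k] by linarith
qed (simp add: r_0)

lemma r_growth: "2 ^ j * r i \<le> r (i + j)"
proof (induction j)
  case (Suc j)
  then show ?case using r_double[of "i + j"] by simp
qed simp

lemma r_mono: "i \<le> j \<Longrightarrow> r i \<le> r j"
  by (rule lift_Suc_mono_le) (use r_double r_pos in \<open>smt (verit)\<close>)

definition f :: "real \<Rightarrow> real" where
  "f t = (INF k. real k + t / r k)"

lemma f_le: "0 \<le> t \<Longrightarrow> f t \<le> real k + t / r k"
  unfolding f_def using r_pos by (intro cINF_lower bdd_belowI[of _ 0]) (auto simp: less_imp_le)

lemma le_f: "(\<And>k. c \<le> real k + t / r k) \<Longrightarrow> c \<le> f t"
  unfolding f_def by (intro cINF_greatest) auto

lemma f_nonneg: "0 \<le> t \<Longrightarrow> 0 \<le> f t"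
  using r_pos by (intro le_f) (simp add: less_imp_le)

lemma f_mono: "0 \<le> s \<Longrightarrow> s \<le> t \<Longrightarrow> f s \<le> f t"
  using r_pos by (intro le_f) (smt (verit) f_le divide_right_mono)

lemma f_le_self: "0 \<le> t \<Longrightarrow> f t \<le> t"
  using f_le[of t 0] r_0 by simp

text \<open>The term \<open>k = 0\<close> is \<open>t\<close> itself, and every later term is at
  least 1. Together with \<open>f_le_self\<close> this makes \<open>f\<close> the identity on
  [0, 1], which preserves the topology.\<close>

lemma min_le_f:
  assumes "0 \<le> t"
  shows "min t 1 \<le> f t"
proof (rule le_f)
  fix k
  have "0 \<le> t / r k" using assms r_pos[of k] by simp
  then show "min t 1 \<le> real k + t / r k" using r_0 by (cases k) auto
qed

lemma f_0: "f 0 = 0"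
  using f_le_self[of 0] f_nonneg[of 0] by simp

lemma f_pos: "0 < t \<Longrightarrow> 0 < f t"
  using min_le_f[of t] by auto

text \<open>The index \<open>max k l\<close> serves for \<open>s + t\<close>: it is at most
  \<open>k + l\<close>, and its larger denominator only shrinks both quotients.\<close>

lemma f_subadditive:
  assumes "0 \<le> s" "0 \<le> t"
  shows "f (s + t) \<le> f s + f t"
proof -
  have *: "f (s + t) \<le> (real k + s / r k) + (real l + t / r l)" for k l
  proof -
    have "s / r (max k l) \<le> s / r k" "t / r (max k l) \<le> t / r l"
      using assms r_pos r_mono by (auto intro!: divide_left_mono)
    moreover have "real (max k l) \<le> real k + real l" by simp
    ultimately show ?thesis
      using f_le[of "s + t" "max k l"] assms by (simp add: add_divide_distrib del: of_nat_max)
  qed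
  \<comment> \<open>The infima over \<open>k\<close> and \<open>l\<close> are taken one after the
    other.\<close>
  have "f (s + t) - (real l + t / r l) \<le> f s" for l
    by (rule le_f) (use *[of _ l] in \<open>simp add: algebra_simps\<close>)
  then have "f (s + t) - f s \<le> f t"
    by (intro le_f) (simp add: algebra_simps)
  then show ?thesis by simp
qed

text \<open>Passing from index \<open>k\<close> to \<open>Suc k\<close> absorbs the factor 2 into
  the denominator and costs 1.\<close>

lemma f_double:
  assumes "0 \<le> t"
  shows "f (2 * t) \<le> f t + 1"
proof -
  have "f (2 * t) - 1 \<le> real k + t / r k" for k
  proof -
    have "2 * t / r (Suc k) \<le> 2 * t / (2 * r k)"
      using assms r_pos[of k] r_pos[of "Suc k"] r_double[of k] by (intro divide_left_mono) auto
    then show ?thesis using f_le[of "2 * t" "Suc k"] assms by simp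
  qed
  then show ?thesis using le_f[of "f (2 * t) - 1" t] by simp
qed

lemma f_r_upper: "f (r k) \<le> real k + 1"
  using f_le[of "r k" k] r_pos[of k] by simp

lemma f_r_lower: "real k \<le> f (r k)"
proof (rule le_f)
  fix j
  show "real k \<le> real j + r k / r j"
  proof (cases "j \<le> k")
    case True
    \<comment> \<open>The quotient is at least \<open>2 ^ i\<close>, which makes up for the missing
      \<open>i\<close>.\<close>
    then obtain i where k: "k = j + i" using le_Suc_ex by blast
    have "real i \<le> 2 ^ i" using of_nat_less_two_power[of i] by (simp add: less_imp_le)
    also have "\<dots> \<le> r k / r j" using r_growth[of i j] r_pos[of j] by (simp add: k field_simps)
    finally show ?thesis by (simp add: k)
  next
    case False
    have "0 < r k / r j" using r_pos by simp
    then show ?thesis using False by simp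
  qed
qed

lemma f_unbounded: "\<not> bdd_above (f ` {0..})"
proof
  assume "bdd_above (f ` {0..})"
  then obtain B where B: "\<And>t. 0 \<le> t \<Longrightarrow> f t \<le> B" by (auto simp: bdd_above_def)
  obtain k where "B < real k" using reals_Archimedean2 by blast
  then show False using B[of "r k"] f_r_lower[of k] r_pos[of k] by linarith
qed

text \<open>A sum is at most twice its larger summand, and doubling costs only 1.\<close>

lemma f_ultra:
  assumes "0 \<le> u" "0 \<le> s" "0 \<le> t" "u \<le> s + t"
  shows "f u \<le> max (f s) (f t) + 1"
proof -
  have "f u \<le> f (2 * max s t)" using assms by (intro f_mono) auto
  also have "\<dots> \<le> f (max s t) + 1" using assms by (intro f_double) auto
  also have "\<dots> = max (f s) (f t) + 1"
    using assms f_mono[of s t] f_mono[of t s] by (auto simp: max_def)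
  finally show ?thesis .
qed

end

section \<open>The rescaled metric space\<close>

locale rescaled_metric_space = doubling_sequence r + Metric_space M d
  for r :: "nat \<Rightarrow> real" and M :: "'a set" and d :: "'a \<Rightarrow> 'a \<Rightarrow> real"
begin

abbreviation d' :: "'a \<Rightarrow> 'a \<Rightarrow> real" where
  "d' \<equiv> \<lambda>x y. f (d x y)"

lemma Metric_space_d': "Metric_space M d'"
proof
  fix x y z
  show "0 \<le> d' x y" by (simp add: f_nonneg)
  show "d' x y = d' y x" by (simp add: commute)
  assume M: "x \<in> M" "y \<in> M"
  show "d' x y = 0 \<longleftrightarrow> x = y"
    using M f_pos[of "d x y"] f_0 zero nonneg[of x y] by (metis less_le)
  assume "z \<in> M"
  then have "d' x z \<le> f (d x y + d y z)" using M by (intro f_mono triangle) auto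
  also have "\<dots> \<le> d' x y + d' y z" by (intro f_subadditive) auto
  finally show "d' x z \<le> d' x y + d' y z" .
qed

lemma hyperbolic_metric_d': "hyperbolic_metric M d'"
  by (rule hyperbolic_metric_if_quasi_ultrametric[where C = 1])
     (auto simp: commute intro!: f_ultra triangle)

lemma coarsely_equivalent_d': "coarsely_equivalent M d d'"
  unfolding coarsely_equivalent_def
  \<comment> \<open>\<open>f\<close> serves as both the lower and the upper control.\<close>
  by (intro exI[of _ f] conjI f_unbounded) (auto simp: f_nonneg f_mono intro!: mono_onI)

lemma topologically_equivalent_d': "topologically_equivalent M d d'"
proof -
  interpret d': Metric_space M d' by (rule Metric_space_d')
  have "mball x e \<subseteq> d'.mball x e" for x e
  proof
    fix y assume "y \<in> mball x e"
    then show "y \<in> d'.mball x e" using f_le_self[OF nonneg, of x y] by auto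
  qed
  \<comment> \<open>The radius is capped at 1 because \<open>min t 1 \<le> f t\<close> bounds
    \<open>t\<close> by \<open>f t\<close> only where \<open>f t < 1\<close>.\<close>
  moreover have "d'.mball x (min e 1) \<subseteq> mball x e" for x e
  proof
    fix y assume "y \<in> d'.mball x (min e 1)"
    then show "y \<in> mball x e" using min_le_f[OF nonneg, of x y] by auto
  qed
  moreover have "0 < min e 1" if "0 < e" for e :: real
    using that by simp
  ultimately have "openin mtopology U \<longleftrightarrow> openin d'.mtopology U" for U
    unfolding openin_mtopology d'.openin_mtopology by (meson subset_trans)
  then show ?thesis
    by (simp add: topologically_equivalent_def topology_eq)
qed

text \<open>Covers transfer back because \<open>f\<close> is nondecreasing and unbounded: large
  \<open>d'\<close> forces large \<open>d\<close>, and bounded \<open>d'\<close> forces bounded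
  \<open>d\<close>.\<close>

lemma asdim_le_d:
  assumes "asdim_le M d' m"
  shows "asdim_le M d m"
proof -
  obtain D where D: "control_function M d' m D" "\<And>s. 0 \<le> s \<Longrightarrow> D s \<noteq> \<infinity>"
    using assms by (auto simp: asdim_le_def)
  \<comment> \<open>The index strictly exceeds the diameter bound at scale \<open>f s + 1\<close>,
    hence so does \<open>f (r (k s))\<close>, and \<open>d\<close>-diameters stay within
    \<open>r (k s)\<close>.\<close>
  define k where "k s = nat (\<lfloor>enn2real (D (f s + 1))\<rfloor> + 1)" for s
  have "control_function M d m (\<lambda>s. ennreal (r (k s)))"
    unfolding control_function_def
  proof (intro allI impI)
    fix s :: real assume s: "0 \<le> s"
    define c where "c = enn2real (D (f s + 1))"
    have c: "0 \<le> c" "D (f s + 1) = ennreal c" "c < real (k s)"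
      using D(2)[of "f s + 1"] f_nonneg[OF s] by (auto simp: c_def k_def less_top)
    have "0 \<le> f s + 1" using f_nonneg[OF s] by simp
    then obtain \<U> :: "nat \<Rightarrow> 'a set set" where
      cover: "(\<Union>i\<in>{1..m+1}. \<Union>(\<U> i)) = M" and
      disj: "\<And>i. i \<in> {1..m+1} \<Longrightarrow> r_disjoint d' (f s + 1) (\<U> i)" and
      diam: "\<And>i U. i \<in> {1..m+1} \<Longrightarrow> U \<in> \<U> i \<Longrightarrow> ediam d' U \<le> ennreal c"
      using D(1) c(2) unfolding control_function_def by metis
    \<comment> \<open>The extra 1 makes \<open>d' x y\<close> strictly larger than
      \<open>f s\<close>, so monotonicity alone suffices.\<close>
    have "s \<le> d x y" if "f s + 1 \<le> d' x y" for x y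
      using that f_mono[of "d x y" s] by force
    then have "r_disjoint d s (\<U> i)" if "i \<in> {1..m+1}" for i
      using disj[OF that] unfolding r_disjoint_def by blast
    moreover have "d x y \<le> r (k s)" if "d' x y \<le> c" for x y
      using that c f_r_lower[of "k s"] f_mono[of "r (k s)" "d x y"] r_pos[of "k s"] by linarith
    then have "ediam d U \<le> ennreal (r (k s))" if "i \<in> {1..m+1}" "U \<in> \<U> i" for i U
      using diam[OF that] c(1) r_pos[of "k s"] by (simp add: ediam_le_ennreal_iff)
    ultimately show "\<exists>\<U>. (\<Union>i\<in>{1..m+1}. \<Union>(\<U> i)) = M \<and>
        (\<forall>i\<in>{1..m+1}. r_disjoint d s (\<U> i)) \<and>
        (\<forall>i\<in>{1..m+1}. \<forall>U\<in>\<U> i. ediam d U \<le> ennreal (r (k s)))"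
      using cover by blast
  qed
  then show ?thesis unfolding asdim_le_def by (intro exI conjI) auto
qed

lemma asdim_AN_le_d':
  assumes D: "control_function M d n D" "\<And>k. D (r k) \<le> ennreal (r (Suc k))"
  shows "asdim_AN_le M d' n"
proof -
  \<comment> \<open>With \<open>k\<close> the ceiling of \<open>s\<close>, diameters are at most
    \<open>f (r (Suc k)) \<le> k + 2 \<le> s + 3\<close>.\<close>
  have "control_function M d' n (\<lambda>s. ennreal (1 * s + 3))"
    unfolding control_function_def
  proof (intro allI impI)
    fix s :: real assume s: "0 \<le> s"
    define k where "k = nat \<lceil>s\<rceil>"
    have k: "s \<le> real k" "real k \<le> s + 1" using s unfolding k_def by linarith+
    have "0 \<le> r k" using r_pos[of k] by simp
    then obtain \<U> :: "nat \<Rightarrow> 'a set set" where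
      cover: "(\<Union>i\<in>{1..n+1}. \<Union>(\<U> i)) = M" and
      disj: "\<And>i. i \<in> {1..n+1} \<Longrightarrow> r_disjoint d (r k) (\<U> i)" and
      diam: "\<And>i U. i \<in> {1..n+1} \<Longrightarrow> U \<in> \<U> i \<Longrightarrow> ediam d U \<le> D (r k)"
      using D(1) unfolding control_function_def by metis
    have "s \<le> d' x y" if "r k \<le> d x y" for x y
      using that f_mono[of "r k" "d x y"] f_r_lower[of k] r_pos[of k] k by linarith
    then have "r_disjoint d' s (\<U> i)" if "i \<in> {1..n+1}" for i
      using disj[OF that] unfolding r_disjoint_def by blast
    moreover have "d' x y \<le> 1 * s + 3" if "d x y \<le> r (Suc k)" for x y
      using that f_mono[of "d x y" "r (Suc k)"] f_r_upper[of "Suc k"] k by simp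
    then have "ediam d' U \<le> ennreal (1 * s + 3)" if "i \<in> {1..n+1}" "U \<in> \<U> i" for i U
      using order_trans[OF diam[OF that] D(2)] s r_pos[of "Suc k"]
      by (simp add: ediam_le_ennreal_iff del: ennreal_plus)
    ultimately show "\<exists>\<U>. (\<Union>i\<in>{1..n+1}. \<Union>(\<U> i)) = M \<and>
        (\<forall>i\<in>{1..n+1}. r_disjoint d' s (\<U> i)) \<and>
        (\<forall>i\<in>{1..n+1}. \<forall>U\<in>\<U> i. ediam d' U \<le> ennreal (1 * s + 3))"
      using cover by blast
  qed
  moreover have "\<forall>s\<ge>0. 0 \<le> 1 * s + (3::real)" by simp
  ultimately show ?thesis unfolding asdim_AN_le_def by blast
qed

end

theorem theorem0p1:
  fixes M :: "'a set" and d :: "'a \<Rightarrow> 'a \<Rightarrow> real" and n :: nat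
  assumes "Metric_space M d"
    and "asdim M d = enat n"
  shows "\<exists>f :: real \<Rightarrow> real. f \<in> {0..} \<rightarrow> {0..} \<and>
    (let d' = (\<lambda>x y. f (d x y)) in
       Metric_space M d' \<and>
       hyperbolic_metric M d' \<and>
       coarsely_equivalent M d d' \<and>
       topologically_equivalent M d d' \<and>
       asdim_AN M d' = enat n)"
proof -
  have "asdim_le M d n"
    using assms(2) LeastI_ex[of "asdim_le M d"] by (auto simp: asdim_def split: if_splits)
  then obtain D where D: "control_function M d n D" "\<And>s. 0 \<le> s \<Longrightarrow> D s \<noteq> \<infinity>"
    by (auto simp: asdim_le_def)
  \<comment> \<open>The first argument of \<open>max\<close> gives the doubling; the second puts the
    diameters at scale \<open>r k\<close> below the next term.\<close>
  define r where "r = rec_nat 1 (\<lambda>_ t. max (2 * t) (enn2real (D t)))"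
  have r_Suc: "r (Suc k) = max (2 * r k) (enn2real (D (r k)))" for k
    by (simp add: r_def)
  interpret Metric_space M d by fact
  interpret rescaled_metric_space r M d
    by unfold_locales (simp_all add: r_Suc, simp add: r_def)
  have "D (r k) \<le> ennreal (r (Suc k))" for k
  proof -
    \<comment> \<open>\<open>enn2real\<close> sends infinity to 0, so finiteness of \<open>D\<close>
      at \<open>r k\<close> enters here.\<close>
    have "D (r k) = ennreal (enn2real (D (r k)))"
      using D(2)[of "r k"] r_pos[of k] by (simp add: less_top)
    also have "\<dots> \<le> ennreal (r (Suc k))" by (simp add: r_Suc ennreal_leI)
    finally show ?thesis .
  qed
  then have "asdim_AN M d' = enat n"
    using asdim_AN_eq_asdim[OF assms(2) asdim_AN_le_d'[OF D(1)] asdim_le_d] by blast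
  moreover have "f \<in> {0..} \<rightarrow> {0..}" by (simp add: f_nonneg)
  ultimately show ?thesis
    unfolding Let_def
    using Metric_space_d' hyperbolic_metric_d' coarsely_equivalent_d' topologically_equivalent_d'
    by blast
qed

end
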